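(* For complete rankings, fix a sequence $W$ and a group $S$. For a rank matrix $R$, let $k_R(S)$ and $\mathrm{rep}_R(S)$ be the numbers of rounds in which $S$ agrees and is represented under $R$, respectively. Then \[ \max_R\left\{\left\lfloor\frac{k_R(S)|S|}{n}\right\rfloor-\mathrm{rep}_R(S)\right\}=\left\lfloor\frac{|S|\,(D_W(S)+F_W(S))}{n}\right\rfloor-F_W(S), \] where the maximum is over all rank matrices $R\in[m]^{|T|\times n}$. Consequently, $W$ satisfies all-rank-PJR if and only if $|S|D_W(S)-(n-|S|)F_W(S)<n$ for every group $S$; and $W$ satisfies all-rank-JR if and only if there is no group $S$ with $F_W(S)=0$ and $|S|D_W(S)\ge n$.
   Context: Model. Voters $V=[n]$, a set $C$ of $m$ candidates, rounds $T=\{1,\dots,|T|\}$ with $n,m,|T|\ge1$. In each round $j$ each voter $i$ has a strict complete ranking $\succ_i^j$ of $C$. A sequence is $W=(w^1,\dots,w^{|T|})\in C^{|T|}$; $w^j$ is the winner of round $j$. A group is a nonempty $S\subseteq V$. Let $\mathrm{rank}_i^j(c)=|\{c':c'\succ_i^j c\}|+1$; the first choice of $i$ in round $j$ is the candidate of rank 1. For $r\in[m]$, $A_i^j(r)=\{c:\mathrm{rank}_i^j(c)\le r\}$. A rank matrix is $R=(r_i^j)\in[m]^{|T|\times n}$; under $R$, voter $i$ approves $A_i^j(r_i^j)$ in round $j$. $S$ agrees in round $j$ if $\bigcap_{i\in S}A_i^j(r_i^j)\ne\varnothing$ and is represented in round $j$ if $w^j\in\bigcup_{i\in S}A_i^j(r_i^j)$.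 $W$ satisfies all-rank-PJR if, for every rank matrix $R$, every positive integer $\ell$ and every group $S$ that agrees in $k>0$ rounds with $|S|\ge\ell n/k$, $S$ is represented in at least $\ell$ rounds. All-rank-JR is the same with "at least $\ell$ rounds" replaced by "at least one round". A candidate $c$ Pareto dominates $c'$ for $S$ in round $j$ if $c\succ_i^j c'$ for all $i\in S$. Define $F_W(S)=|\{j\in T: w^j\text{ is the first choice in round }j\text{ of some }i\in S\}|$ and $D_W(S)=|\{j\in T: w^j\text{ is Pareto dominated for }S\text{ in round }j\text{ by some candidate}\}|$. *)

theory Defs
  imports Complex_Main "HOL-Library.FuncSet"
begin

text \<open>
  Voters are \<open>{1..n}\<close>, rounds are \<open>{1..t}\<close>, and \<open>C\<close> is the set of candidates (so \<open>m = card C\<close>).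
  A profile \<open>pref\<close> is read as: \<open>pref i j c c'\<close> iff voter \<open>i\<close> strictly prefers \<open>c\<close> to \<open>c'\<close> in
  round \<open>j\<close>. The winner of round \<open>j\<close> is \<open>W j\<close>.
\<close>

type_synonym 'c ranking = "'c \<Rightarrow> 'c \<Rightarrow> bool"
type_synonym 'c profile = "nat \<Rightarrow> nat \<Rightarrow> 'c ranking"

definition strict_ranking_on :: "'c set \<Rightarrow> 'c ranking \<Rightarrow> bool" where
  "strict_ranking_on C P \<longleftrightarrow> irreflp_on C P \<and> transp_on C P \<and> totalp_on C P"

definition complete_profile :: "nat \<Rightarrow> nat \<Rightarrow> 'c set \<Rightarrow> 'c profile \<Rightarrow> bool" where
  "complete_profile n t C pref \<longleftrightarrow>
     (\<forall>i\<in>{1..n}. \<forall>j\<in>{1..t}. strict_ranking_on C (pref i j))"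

definition voter_group :: "nat \<Rightarrow> nat set \<Rightarrow> bool" where
  "voter_group n S \<longleftrightarrow> S \<noteq> {} \<and> S \<subseteq> {1..n}"

definition cand_rank :: "'c set \<Rightarrow> 'c ranking \<Rightarrow> 'c \<Rightarrow> nat" where
  "cand_rank C P c = card {c' \<in> C. P c' c} + 1"

definition first_choice :: "'c set \<Rightarrow> 'c ranking \<Rightarrow> 'c \<Rightarrow> bool" where
  "first_choice C P c \<longleftrightarrow> c \<in> C \<and> cand_rank C P c = 1"

definition approval_set :: "'c set \<Rightarrow> 'c ranking \<Rightarrow> nat \<Rightarrow> 'c set" where
  "approval_set C P r = {c \<in> C. cand_rank C P c \<le> r}"

text \<open>
  Rows of a rank matrix are rounds and columns are voters: \<open>R j i\<close> is the approval threshold of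
  voter \<open>i\<close> in round \<open>j\<close>. Extensional functions make this a finite set, with one element per matrix.
\<close>

definition rank_matrices :: "nat \<Rightarrow> nat \<Rightarrow> nat \<Rightarrow> (nat \<Rightarrow> nat \<Rightarrow> nat) set" where
  "rank_matrices n t m = ({1..t} \<rightarrow>\<^sub>E ({1..n} \<rightarrow>\<^sub>E {1..m}))"

definition agrees_in ::
  "'c set \<Rightarrow> 'c profile \<Rightarrow> (nat \<Rightarrow> nat \<Rightarrow> nat) \<Rightarrow> nat set \<Rightarrow> nat \<Rightarrow> bool" where
  "agrees_in C pref R S j \<longleftrightarrow> (\<Inter>i\<in>S. approval_set C (pref i j) (R j i)) \<noteq> {}"

definition represented_in ::
  "'c set \<Rightarrow> 'c profile \<Rightarrow> (nat \<Rightarrow> 'c) \<Rightarrow> (nat \<Rightarrow> nat \<Rightarrow> nat) \<Rightarrow> nat set \<Rightarrow> nat \<Rightarrow> bool" where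
  "represented_in C pref W R S j \<longleftrightarrow> W j \<in> (\<Union>i\<in>S. approval_set C (pref i j) (R j i))"

definition num_agree ::
  "nat \<Rightarrow> 'c set \<Rightarrow> 'c profile \<Rightarrow> (nat \<Rightarrow> nat \<Rightarrow> nat) \<Rightarrow> nat set \<Rightarrow> nat" where
  "num_agree t C pref R S = card {j \<in> {1..t}. agrees_in C pref R S j}"

definition num_rep ::
  "nat \<Rightarrow> 'c set \<Rightarrow> 'c profile \<Rightarrow> (nat \<Rightarrow> 'c) \<Rightarrow> (nat \<Rightarrow> nat \<Rightarrow> nat) \<Rightarrow> nat set \<Rightarrow> nat" where
  "num_rep t C pref W R S = card {j \<in> {1..t}. represented_in C pref W R S j}"

definition all_rank_PJR :: "nat \<Rightarrow> nat \<Rightarrow> 'c set \<Rightarrow> 'c profile \<Rightarrow> (nat \<Rightarrow> 'c) \<Rightarrow> bool" where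
  "all_rank_PJR n t C pref W \<longleftrightarrow>
     (\<forall>R \<in> rank_matrices n t (card C). \<forall>l k :: nat. \<forall>S.
        l > 0 \<longrightarrow> voter_group n S \<longrightarrow> k = num_agree t C pref R S \<longrightarrow> k > 0 \<longrightarrow>
        real (card S) \<ge> real l * real n / real k \<longrightarrow>
        num_rep t C pref W R S \<ge> l)"

definition all_rank_JR :: "nat \<Rightarrow> nat \<Rightarrow> 'c set \<Rightarrow> 'c profile \<Rightarrow> (nat \<Rightarrow> 'c) \<Rightarrow> bool" where
  "all_rank_JR n t C pref W \<longleftrightarrow>
     (\<forall>R \<in> rank_matrices n t (card C). \<forall>l k :: nat. \<forall>S.
        l > 0 \<longrightarrow> voter_group n S \<longrightarrow> k = num_agree t C pref R S \<longrightarrow> k > 0 \<longrightarrow>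
        real (card S) \<ge> real l * real n / real k \<longrightarrow>
        num_rep t C pref W R S \<ge> 1)"

definition pareto_dominates :: "'c profile \<Rightarrow> nat set \<Rightarrow> nat \<Rightarrow> 'c \<Rightarrow> 'c \<Rightarrow> bool" where
  "pareto_dominates pref S j c c' \<longleftrightarrow> (\<forall>i\<in>S. pref i j c c')"

definition num_first ::
  "nat \<Rightarrow> 'c set \<Rightarrow> 'c profile \<Rightarrow> (nat \<Rightarrow> 'c) \<Rightarrow> nat set \<Rightarrow> nat" where
  "num_first t C pref W S = card {j \<in> {1..t}. \<exists>i\<in>S. first_choice C (pref i j) (W j)}"

definition num_dominated ::
  "nat \<Rightarrow> 'c set \<Rightarrow> 'c profile \<Rightarrow> (nat \<Rightarrow> 'c) \<Rightarrow> nat set \<Rightarrow> nat" where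
  "num_dominated t C pref W S =
     card {j \<in> {1..t}. \<exists>c\<in>C. pareto_dominates pref S j c (W j)}"

end

theory Submission
  imports Defs
begin

text \<open>
  A round in which \<open>S\<close> agrees without being represented is a round where the commonly approved
  candidate Pareto dominates the winner, and \<open>S\<close> is represented in every first-choice round since
  thresholds are at least 1. Hence \<open>k \<le> D + rep\<close> and \<open>F \<le> rep\<close>. As \<open>card S \<le> n\<close>, each represented
  round beyond the first-choice rounds raises \<open>\<lfloor>k * card S / n\<rfloor>\<close> by at most 1, so it is never
  profitable. Both bounds are tight for the matrix in which everybody approves everything in
  first-choice rounds and otherwise just the candidates preferred to the winner.
\<close>

section \<open>Ranks of candidates and integer rounding\<close>

text \<open>For \<open>P x y\<close>, transitivity and irreflexivity make the candidates above
  \<open>x\<close> a proper subset of those above \<open>y\<close>; totality then yields the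
  converse.\<close>

lemma cand_rank_less_iff:
  assumes "finite C" "strict_ranking_on C P" "c \<in> C" "d \<in> C"
  shows "cand_rank C P c < cand_rank C P d \<longleftrightarrow> P c d"
proof -
  have irr: "\<not> P x x" if "x \<in> C" for x
    using assms(2) that by (auto simp: strict_ranking_on_def irreflp_on_def)
  have trans: "P x z" if "x \<in> C" "y \<in> C" "z \<in> C" "P x y" "P y z" for x y z
    using assms(2) that by (meson strict_ranking_on_def transp_onD)
  have total: "P x y \<or> P y x" if "x \<in> C" "y \<in> C" "x \<noteq> y" for x y
    using assms(2) that by (auto simp: strict_ranking_on_def totalp_on_def)
  have mono: "cand_rank C P x < cand_rank C P y" if "x \<in> C" "y \<in> C" "P x y" for x y
  proof -
    have "{c' \<in> C. P c' x} \<subset> {c' \<in> C. P c' y}"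
      using that irr trans by blast
    then show ?thesis
      using assms(1) by (simp add: cand_rank_def psubset_card_mono)
  qed
  show ?thesis
    using mono total assms(3,4) by (metis less_asym less_irrefl)
qed

lemma cand_rank_le_card:
  assumes "finite C" "strict_ranking_on C P" "c \<in> C"
  shows "cand_rank C P c \<le> card C"
proof -
  have "{c' \<in> C. P c' c} \<subset> C"
    using assms by (auto simp: strict_ranking_on_def irreflp_on_def)
  then show ?thesis
    using assms(1) by (simp add: cand_rank_def Suc_leI psubset_card_mono)
qed

lemma floor_nat_quotient_diff_le_0_iff:
  assumes "n > 0"
  shows "\<lfloor>real a / real n\<rfloor> - int b \<le> 0 \<longleftrightarrow> a < Suc b * n"
proof -
  have "\<lfloor>real a / real n\<rfloor> - int b \<le> 0 \<longleftrightarrow> a div n < Suc b"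
    by (simp add: floor_divide_of_nat_eq less_Suc_eq_le)
  also have "\<dots> \<longleftrightarrow> a < Suc b * n"
    using assms by (simp add: div_less_iff_less_mult)
  finally show ?thesis .
qed

text \<open>One group is fixed, since the extremal rank matrix built below depends on
  \<open>S\<close>; the final theorem applies the locale to each group separately.\<close>

locale group_election =
  fixes n t :: nat and C :: "'c set" and pref :: "'c profile" and W :: "nat \<Rightarrow> 'c"
    and S :: "nat set"
  assumes n_pos: "n > 0"
    and finite_C: "finite C"
    and card_C_pos: "card C > 0"
    and profile: "complete_profile n t C pref"
    and winner: "W \<in> {1..t} \<rightarrow> C"
    and group: "voter_group n S"
begin

section \<open>Bounds for an arbitrary rank matrix\<close>

lemma ranking: "i \<in> S \<Longrightarrow> j \<in> {1..t} \<Longrightarrow> strict_ranking_on C (pref i j)"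
  using profile group by (auto simp: complete_profile_def voter_group_def)

lemma winner_in: "j \<in> {1..t} \<Longrightarrow> W j \<in> C"
  using winner by auto

lemma card_group_le: "card S \<le> n"
  using group card_mono[of "{1..n}" S] by (auto simp: voter_group_def)

abbreviation "first_round j \<equiv> \<exists>i\<in>S. first_choice C (pref i j) (W j)"
abbreviation "dominated_round j \<equiv> \<exists>c\<in>C. pareto_dominates pref S j c (W j)"

text \<open>If \<open>S\<close> is unrepresented, each member's threshold lies at or above the rank
  of the common candidate but strictly below the rank of the winner.\<close>

lemma agrees_imp_dominated_or_represented:
  assumes "j \<in> {1..t}" "agrees_in C pref R S j"
  shows "dominated_round j \<or> represented_in C pref W R S j"
proof (rule disjCI)
  assume unrep: "\<not> represented_in C pref W R S j"
  obtain c where c: "c \<in> approval_set C (pref i j) (R j i)" if "i \<in> S" for i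
    using assms(2) by (auto simp: agrees_in_def)
  \<comment> \<open>Nonemptiness of \<open>S\<close> is what puts \<open>c\<close> into
    \<open>C\<close>.\<close>
  have "c \<in> C"
    using c group by (auto simp: voter_group_def approval_set_def)
  moreover have "pref i j c (W j)" if "i \<in> S" for i
  proof -
    have "W j \<notin> approval_set C (pref i j) (R j i)"
      using unrep that by (auto simp: represented_in_def)
    with c[OF that] have "cand_rank C (pref i j) c < cand_rank C (pref i j) (W j)"
      using winner_in[OF assms(1)] by (auto simp: approval_set_def)
    then show ?thesis
      using cand_rank_less_iff[OF finite_C ranking[OF that assms(1)] \<open>c \<in> C\<close> winner_in[OF assms(1)]]
      by simp
  qed
  ultimately show "dominated_round j"
    by (auto simp: pareto_dominates_def)
qed

lemma first_round_imp_represented: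
  assumes "R \<in> rank_matrices n t (card C)" "j \<in> {1..t}" "first_round j"
  shows "represented_in C pref W R S j"
proof -
  obtain i where i: "i \<in> S" "first_choice C (pref i j) (W j)"
    using assms(3) by blast
  then have "i \<in> {1..n}"
    using group by (auto simp: voter_group_def)
  with assms(1,2) have "R j i \<in> {1..card C}"
    unfolding rank_matrices_def by (meson PiE_mem)
  with i show ?thesis
    by (auto simp: represented_in_def first_choice_def approval_set_def intro!: bexI[of _ i])
qed

lemma num_agree_le: "num_agree t C pref R S \<le> num_dominated t C pref W S + num_rep t C pref W R S"
proof -
  have "num_agree t C pref R S
      \<le> card ({j \<in> {1..t}. dominated_round j} \<union> {j \<in> {1..t}. represented_in C pref W R S j})"
    unfolding num_agree_def
    using agrees_imp_dominated_or_represented by (intro card_mono) auto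
  also have "\<dots> \<le> num_dominated t C pref W S + num_rep t C pref W R S"
    unfolding num_dominated_def num_rep_def by (rule card_Un_le)
  finally show ?thesis .
qed

lemma num_first_le_num_rep:
  "R \<in> rank_matrices n t (card C) \<Longrightarrow> num_first t C pref W S \<le> num_rep t C pref W R S"
  unfolding num_first_def num_rep_def
  using first_round_imp_represented by (intro card_mono) auto

text \<open>Nothing is ranked above a first choice. This makes the rounds counted by D and F
  disjoint, so that their numbers add up exactly.\<close>

lemma not_first_and_dominated:
  assumes "first_round j" "dominated_round j"
  shows False
proof -
  obtain i where "i \<in> S" "first_choice C (pref i j) (W j)"
    using assms(1) by blast
  with assms(2) show False
    using finite_C by (auto simp: first_choice_def cand_rank_def pareto_dominates_def)
qed

section \<open>The extremal rank matrix\<close>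

text \<open>
  In rounds that are not first-choice rounds, all members of \<open>S\<close> rank the winner at least second;
  the maximum with 1 only matters for voters outside \<open>S\<close>.
\<close>

definition optimal_matrix :: "nat \<Rightarrow> nat \<Rightarrow> nat" where
  "optimal_matrix = (\<lambda>j\<in>{1..t}. \<lambda>i\<in>{1..n}.
     if first_round j then card C else max 1 (cand_rank C (pref i j) (W j) - 1))"

lemma optimal_matrix_in: "optimal_matrix \<in> rank_matrices n t (card C)"
proof -
  have "cand_rank C (pref i j) (W j) \<le> card C" if "j \<in> {1..t}" "i \<in> {1..n}" for i j
    using that profile winner_in
    by (intro cand_rank_le_card finite_C) (auto simp: complete_profile_def)
  then show ?thesis
    using card_C_pos by (force simp: optimal_matrix_def rank_matrices_def intro!: PiE_I)
qed

lemma optimal_approval_first: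
  assumes "j \<in> {1..t}" "i \<in> S" "first_round j"
  shows "approval_set C (pref i j) (optimal_matrix j i) = C"
proof -
  have "i \<in> {1..n}"
    using assms(2) group by (auto simp: voter_group_def)
  then show ?thesis
    using assms cand_rank_le_card[OF finite_C ranking[OF assms(2,1)]]
    by (auto simp: optimal_matrix_def approval_set_def)
qed

text \<open>A threshold one below the rank of the winner cuts off the winner and everything worse,
  and nothing else.\<close>

lemma optimal_approval_not_first:
  assumes "j \<in> {1..t}" "i \<in> S" "\<not> first_round j"
  shows "approval_set C (pref i j) (optimal_matrix j i) = {c \<in> C. pref i j c (W j)}"
proof -
  let ?r = "cand_rank C (pref i j) (W j)"
  have "i \<in> {1..n}"
    using assms(2) group by (auto simp: voter_group_def)
  \<comment> \<open>Rank 1 would make this a first-choice round, so neither \<open>max\<close> nor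
    truncated subtraction alters \<open>?r - 1\<close>.\<close>
  moreover have "?r \<noteq> 1"
    using assms winner_in by (auto simp: first_choice_def)
  then have "?r > 1"
    by (simp add: cand_rank_def)
  ultimately have "optimal_matrix j i = ?r - 1"
    using assms by (auto simp: optimal_matrix_def)
  then have "approval_set C (pref i j) (optimal_matrix j i) = {c \<in> C. cand_rank C (pref i j) c < ?r}"
    using \<open>?r > 1\<close> by (auto simp: approval_set_def)
  then show ?thesis
    using cand_rank_less_iff[OF finite_C ranking[OF assms(2,1)] _ winner_in[OF assms(1)]] by auto
qed

text \<open>Outside first-choice rounds, a represented winner would have to be preferred to
  itself.\<close>

lemma optimal_represented_iff:
  assumes "j \<in> {1..t}"
  shows "represented_in C pref W optimal_matrix S j \<longleftrightarrow> first_round j"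
proof
  assume rep: "represented_in C pref W optimal_matrix S j"
  show "first_round j"
  proof (rule ccontr)
    assume "\<not> first_round j"
    then obtain i where i: "i \<in> S" "pref i j (W j) (W j)"
      using rep optimal_approval_not_first[OF assms] by (auto simp: represented_in_def)
    then show False
      using ranking[OF i(1) assms] winner_in[OF assms]
      by (auto simp: strict_ranking_on_def irreflp_on_def)
  qed
qed (rule first_round_imp_represented[OF optimal_matrix_in assms])

text \<open>Full approval makes the winner itself a common candidate in first-choice rounds;
  elsewhere the commonly approved candidates are exactly the Pareto dominators of the
  winner.\<close>

lemma optimal_agrees_iff:
  assumes "j \<in> {1..t}"
  shows "agrees_in C pref optimal_matrix S j \<longleftrightarrow> dominated_round j \<or> first_round j"
proof (cases "first_round j")
  case True
  then show ?thesis
    using optimal_approval_first[OF assms] winner_in[OF assms] by (auto simp: agrees_in_def)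
next
  case False
  then have "agrees_in C pref optimal_matrix S j \<longleftrightarrow> (\<Inter>i\<in>S. {c \<in> C. pref i j c (W j)}) \<noteq> {}"
    using optimal_approval_not_first[OF assms] by (simp add: agrees_in_def)
  also have "\<dots> \<longleftrightarrow> dominated_round j"
    using group by (auto simp: pareto_dominates_def voter_group_def)
  finally show ?thesis
    using False by blast
qed

lemma num_rep_optimal: "num_rep t C pref W optimal_matrix S = num_first t C pref W S"
  unfolding num_rep_def num_first_def
  using optimal_represented_iff by (intro arg_cong[where f = card]) blast

lemma num_agree_optimal:
  "num_agree t C pref optimal_matrix S = num_dominated t C pref W S + num_first t C pref W S"
proof -
  have "{j \<in> {1..t}. agrees_in C pref optimal_matrix S j}
      = {j \<in> {1..t}. dominated_round j} \<union> {j \<in> {1..t}. first_round j}"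
    using optimal_agrees_iff by blast
  moreover have "{j \<in> {1..t}. dominated_round j} \<inter> {j \<in> {1..t}. first_round j} = {}"
    using not_first_and_dominated by blast
  ultimately show ?thesis
    unfolding num_agree_def num_dominated_def num_first_def by (simp add: card_Un_disjoint)
qed

section \<open>The deficit and its maximum\<close>

text \<open>Integer entitlement minus actual representation: positive values mark violations of the
  PJR condition for \<open>S\<close> under \<open>R\<close>.\<close>

definition deficit :: "(nat \<Rightarrow> nat \<Rightarrow> nat) \<Rightarrow> int" where
  "deficit R = \<lfloor>real (num_agree t C pref R S) * real (card S) / real n\<rfloor>
               - int (num_rep t C pref W R S)"

lemma deficit_le_optimal:
  assumes "R \<in> rank_matrices n t (card C)"
  shows "deficit R \<le> deficit optimal_matrix"
proof -
  let ?D = "num_dominated t C pref W S" and ?F = "num_first t C pref W S"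
  \<comment> \<open>The represented rounds beyond the first-choice ones; \<open>?F\<close> is a
    lower bound for \<open>num_rep\<close>, so the subtraction does not truncate.\<close>
  define e where "e = num_rep t C pref W R S - ?F"
  have rep: "num_rep t C pref W R S = ?F + e"
    using num_first_le_num_rep[OF assms] by (simp add: e_def)
  have "num_agree t C pref R S * card S \<le> (?D + ?F + e) * card S"
    using num_agree_le[of R] rep by (intro mult_right_mono) auto
  also have "\<dots> \<le> (?D + ?F) * card S + e * n"
    using card_group_le by (simp add: add_mult_distrib)
  finally have "num_agree t C pref R S * card S div n \<le> ((?D + ?F) * card S + e * n) div n"
    by (rule div_le_mono)
  \<comment> \<open>The summand \<open>e * n\<close> leaves the quotient as exactly
    \<open>e\<close>, which the \<open>e\<close> extra represented rounds cancel.\<close>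
  also have "\<dots> = (?D + ?F) * card S div n + e"
    using n_pos by simp
  finally show ?thesis
    by (simp add: deficit_def num_agree_optimal num_rep_optimal rep floor_divide_of_nat_eq
        flip: of_nat_mult of_nat_add)
qed

lemma Max_deficit: "Max (deficit ` rank_matrices n t (card C)) = deficit optimal_matrix"
proof (rule Max_eqI)
  show "finite (deficit ` rank_matrices n t (card C))"
    unfolding rank_matrices_def by (intro finite_imageI finite_PiE) simp_all
qed (use deficit_le_optimal optimal_matrix_in in auto)

lemma deficit_le_0_iff:
  "deficit R \<le> 0 \<longleftrightarrow> num_agree t C pref R S * card S < Suc (num_rep t C pref W R S) * n"
  using floor_nat_quotient_diff_le_0_iff[OF n_pos] by (simp add: deficit_def flip: of_nat_mult)

text \<open>This is (D + F) * \<open>card S\<close> < (F + 1) * \<open>n\<close> with the F terms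
  collected on the left.\<close>

lemma deficit_optimal_le_0_iff:
  "deficit optimal_matrix \<le> 0 \<longleftrightarrow>
     int (card S) * int (num_dominated t C pref W S)
       - (int n - int (card S)) * int (num_first t C pref W S) < int n"
proof -
  have "deficit optimal_matrix \<le> 0 \<longleftrightarrow>
      int ((num_dominated t C pref W S + num_first t C pref W S) * card S)
        < int (Suc (num_first t C pref W S) * n)"
    unfolding deficit_le_0_iff num_agree_optimal num_rep_optimal of_nat_less_iff ..
  then show ?thesis
    by (simp add: algebra_simps)
qed

section \<open>PJR and JR for a single group\<close>

lemma quota_iff:
  assumes "k > 0"
  shows "real (card S) \<ge> real l * real n / real k \<longleftrightarrow> l * n \<le> k * card S"
proof -
  have "real (card S) \<ge> real l * real n / real k \<longleftrightarrow> real (l * n) \<le> real (k * card S)"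
    using assms by (simp add: field_simps)
  then show ?thesis
    by (simp only: of_nat_le_iff)
qed

text \<open>Every \<open>l\<close> within the quota is at most \<open>num_rep\<close> exactly when
  the next integer \<open>Suc ?r\<close> exceeds the quota, so only that value has to be
  tested.\<close>

lemma PJR_condition_iff:
  "(\<forall>l k :: nat. l > 0 \<longrightarrow> k = num_agree t C pref R S \<longrightarrow> k > 0 \<longrightarrow>
      real (card S) \<ge> real l * real n / real k \<longrightarrow> num_rep t C pref W R S \<ge> l)
   \<longleftrightarrow> deficit R \<le> 0" (is "?L \<longleftrightarrow> ?R")
proof -
  let ?k = "num_agree t C pref R S" and ?r = "num_rep t C pref W R S"
  show ?thesis
  proof
    assume L: ?L
    show ?R
    proof (rule ccontr)
      assume "\<not> ?R"
      then have le: "Suc ?r * n \<le> ?k * card S"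
        by (simp add: deficit_le_0_iff)
      \<comment> \<open>The left side of \<open>le\<close> is positive, which rules out
        \<open>?k = 0\<close>.\<close>
      then have "?k > 0"
        using n_pos by (auto intro: Nat.gr0I)
      with L le have "Suc ?r \<le> ?r"
        using quota_iff by blast
      then show False
        by simp
    qed
  next
    assume ?R
    show ?L
    proof (intro allI impI)
      fix l k :: nat
      assume "k = ?k" "k > 0" "real (card S) \<ge> real l * real n / real k"
      then have "l * n \<le> ?k * card S"
        using quota_iff by blast
      with \<open>?R\<close> have "l * n < Suc ?r * n"
        unfolding deficit_le_0_iff by linarith
      then show "l \<le> ?r"
        by (simp only: mult_less_cancel2 less_Suc_eq_le)
    qed
  qed
qed

text \<open>The deficit is largest at \<open>optimal_matrix\<close>, so this one matrix decides the
  condition for all of them.\<close>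

lemma PJR_group_iff:
  "(\<forall>R \<in> rank_matrices n t (card C). \<forall>l k :: nat. l > 0 \<longrightarrow> k = num_agree t C pref R S \<longrightarrow> k > 0 \<longrightarrow>
      real (card S) \<ge> real l * real n / real k \<longrightarrow> num_rep t C pref W R S \<ge> l)
   \<longleftrightarrow> deficit optimal_matrix \<le> 0"
  unfolding PJR_condition_iff using deficit_le_optimal optimal_matrix_in by force

text \<open>If F = 0, then under \<open>optimal_matrix\<close> the group is never represented and
  agrees in D rounds, so \<open>l = 1\<close> already gives a violation. Conversely, zero
  representation forces F = 0 and agreement in at most D rounds.\<close>

lemma JR_group_iff:
  "(\<forall>R \<in> rank_matrices n t (card C). \<forall>l k :: nat. l > 0 \<longrightarrow> k = num_agree t C pref R S \<longrightarrow> k > 0 \<longrightarrow>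
      real (card S) \<ge> real l * real n / real k \<longrightarrow> num_rep t C pref W R S \<ge> 1)
   \<longleftrightarrow> \<not> (num_first t C pref W S = 0 \<and> card S * num_dominated t C pref W S \<ge> n)"
  (is "?L \<longleftrightarrow> \<not> (?F = 0 \<and> card S * ?D \<ge> n)")
proof
  assume L: ?L
  show "\<not> (?F = 0 \<and> card S * ?D \<ge> n)"
  proof
    assume F: "?F = 0 \<and> card S * ?D \<ge> n"
    then have "?D > 0"
      using n_pos by (auto intro: Nat.gr0I)
    moreover have "num_agree t C pref optimal_matrix S = ?D"
      using F by (simp add: num_agree_optimal)
    moreover have "real (card S) \<ge> real (1::nat) * real n / real ?D"
      using F quota_iff[OF \<open>?D > 0\<close>, of 1] by (simp add: mult.commute)
    ultimately have "num_rep t C pref W optimal_matrix S \<ge> 1"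
      using L optimal_matrix_in zero_less_one by metis
    then show False
      using F by (simp add: num_rep_optimal)
  qed
next
  assume nF: "\<not> (?F = 0 \<and> card S * ?D \<ge> n)"
  show ?L
  proof (intro ballI allI impI)
    fix R and l k :: nat
    assume R: "R \<in> rank_matrices n t (card C)"
      and "l > 0" "k = num_agree t C pref R S" "k > 0"
      and "real (card S) \<ge> real l * real n / real k"
    then have "l * n \<le> num_agree t C pref R S * card S"
      using quota_iff by blast
    moreover have "n \<le> l * n"
      using \<open>l > 0\<close> by simp
    moreover have "num_agree t C pref R S * card S \<le> (?D + num_rep t C pref W R S) * card S"
      using num_agree_le by (rule mult_right_mono) simp
    ultimately have "n \<le> (?D + num_rep t C pref W R S) * card S"
      by linarith
    then show "num_rep t C pref W R S \<ge> 1"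
      using nF num_first_le_num_rep[OF R]
      by (cases "num_rep t C pref W R S = 0") (auto simp: mult.commute)
  qed
qed

end

section \<open>All groups together\<close>

theorem theorem3p6:
  fixes n t :: nat and C :: "'c set" and pref :: "'c profile" and W :: "nat \<Rightarrow> 'c"
  assumes "n \<ge> 1" and "t \<ge> 1" and "finite C" and "card C \<ge> 1"
    and "complete_profile n t C pref"
    and "W \<in> {1..t} \<rightarrow> C"
  shows "(\<forall>S. voter_group n S \<longrightarrow>
            Max ((\<lambda>R. \<lfloor>real (num_agree t C pref R S) * real (card S) / real n\<rfloor>
                        - int (num_rep t C pref W R S)) ` rank_matrices n t (card C))
            = \<lfloor>real (card S) * (real (num_dominated t C pref W S) + real (num_first t C pref W S))
                 / real n\<rfloor>
              - int (num_first t C pref W S))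
       \<and> (all_rank_PJR n t C pref W \<longleftrightarrow>
            (\<forall>S. voter_group n S \<longrightarrow>
               int (card S) * int (num_dominated t C pref W S)
               - (int n - int (card S)) * int (num_first t C pref W S) < int n))
       \<and> (all_rank_JR n t C pref W \<longleftrightarrow>
            \<not> (\<exists>S. voter_group n S \<and> num_first t C pref W S = 0 \<and>
                 card S * num_dominated t C pref W S \<ge> n))"
proof -
  have election: "group_election n t C pref W S" if "voter_group n S" for S
    using assms that by unfold_locales simp_all
  have "Max ((\<lambda>R. \<lfloor>real (num_agree t C pref R S) * real (card S) / real n\<rfloor>
                        - int (num_rep t C pref W R S)) ` rank_matrices n t (card C))
            = \<lfloor>real (card S) * (real (num_dominated t C pref W S) + real (num_first t C pref W S))
                 / real n\<rfloor>
              - int (num_first t C pref W S)" if "voter_group n S" for S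
  proof -
    interpret group_election n t C pref W S
      using election[OF that] .
    show ?thesis
      using Max_deficit
      by (simp add: deficit_def num_agree_optimal num_rep_optimal mult.commute cong: image_cong_simp)
  qed
  moreover have "all_rank_PJR n t C pref W \<longleftrightarrow>
            (\<forall>S. voter_group n S \<longrightarrow>
               int (card S) * int (num_dominated t C pref W S)
               - (int n - int (card S)) * int (num_first t C pref W S) < int n)"
  proof -
    \<comment> \<open>The group is now quantified before the matrix, so that the criterion for a
      single group, with its own extremal matrix, applies.\<close>
    have "all_rank_PJR n t C pref W \<longleftrightarrow> (\<forall>S. voter_group n S \<longrightarrow>
       (\<forall>R \<in> rank_matrices n t (card C). \<forall>l k :: nat. l > 0 \<longrightarrow> k = num_agree t C pref R S \<longrightarrow> k > 0 \<longrightarrow>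
          real (card S) \<ge> real l * real n / real k \<longrightarrow> num_rep t C pref W R S \<ge> l))"
      unfolding all_rank_PJR_def Ball_def by iprover
    also have "\<dots> \<longleftrightarrow> (\<forall>S. voter_group n S \<longrightarrow>
               int (card S) * int (num_dominated t C pref W S)
               - (int n - int (card S)) * int (num_first t C pref W S) < int n)"
      by (intro all_cong1 imp_cong refl
          trans[OF group_election.PJR_group_iff group_election.deficit_optimal_le_0_iff] election)
    finally show ?thesis .
  qed
  moreover have "all_rank_JR n t C pref W \<longleftrightarrow>
            \<not> (\<exists>S. voter_group n S \<and> num_first t C pref W S = 0 \<and>
                 card S * num_dominated t C pref W S \<ge> n)"
  proof -
    have "all_rank_JR n t C pref W \<longleftrightarrow> (\<forall>S. voter_group n S \<longrightarrow>
       (\<forall>R \<in> rank_matrices n t (card C). \<forall>l k :: nat. l > 0 \<longrightarrow> k = num_agree t C pref R S \<longrightarrow> k > 0 \<longrightarrow>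
          real (card S) \<ge> real l * real n / real k \<longrightarrow> num_rep t C pref W R S \<ge> 1))"
      unfolding all_rank_JR_def Ball_def by iprover
    also have "\<dots> \<longleftrightarrow> (\<forall>S. voter_group n S \<longrightarrow>
        \<not> (num_first t C pref W S = 0 \<and> card S * num_dominated t C pref W S \<ge> n))"
      by (intro all_cong1 imp_cong refl group_election.JR_group_iff election)
    finally show ?thesis
      by blast
  qed
  ultimately show ?thesis
    by blast
qed

end
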